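(* For all $\alpha,\beta\in\mathcal{L}$: (i) $\vdash_{\mathbf{vD}}\alpha\longrightarrow(\sim\alpha\longrightarrow\beta)$; (ii) $\vdash_{\mathbf{vD}}\sim\alpha\lor\alpha$.
   Context: Let $V$ be a denumerable set of propositional variables and $\mathcal{L}$ the set of formulas generated from $V$ by the binary connectives $\land,\lor,\longrightarrow$ and the unary connectives $\neg,\circ$. Fix a formula $\beta_0$ and set $\bot:=\beta_0\land(\neg\beta_0\land\circ\beta_0)$; for every formula $\alpha$ let $\sim\alpha$ abbreviate $\alpha\longrightarrow\bot$. The logic $\mathbf{vD}=\langle\mathcal{L},\vdash_{\mathbf{vD}}\rangle$ has the following axiom schemas (for all $\alpha,\beta,\gamma\in\mathcal{L}$): (1) $\alpha\to(\beta\to\alpha)$; (2) $(\alpha\to(\beta\to\gamma))\to((\alpha\to\beta)\to(\alpha\to\gamma))$; (3) $\alpha\to(\beta\to(\alpha\land\beta))$; (4) $(\alpha\land\beta)\to\alpha$; (5) $(\alpha\land\beta)\to\beta$; (6) $\alpha\to(\alpha\lor\beta)$; (7) $\beta\to(\alpha\lor\beta)$; (8) $(\alpha\to\beta)\lor\alpha$; (9) $\alpha\lor\neg\alpha$; (10) $(\alpha\to\gamma)\to((\neg\alpha\to\gamma)\to((\alpha\lor\neg\alpha)\to\gamma))$; (11) $((\alpha\to\beta)\to\gamma)\to((\alpha\to\gamma)\to(((\alpha\to\beta)\lor\alpha)\to\gamma))$; (12) $\circ\alpha\to(\alpha\to(\neg\alpha\to\beta))$; (13) $\circ\alpha\lor(\alpha\land\neg\alpha)$;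 (14) $(\circ\alpha\to\gamma)\to(((\alpha\land\neg\alpha)\to\gamma)\to((\circ\alpha\lor(\alpha\land\neg\alpha))\to\gamma))$; (15) $\sim\neg\alpha\to\sim\neg\sim\neg\alpha$; (16) $\sim\neg\sim\neg\alpha\to\sim\neg\alpha$; (17) $\sim\neg(\alpha\land\beta)\to(\sim\neg\alpha\land\sim\neg\beta)$; (18) $(\sim\neg\alpha\land\sim\neg\beta)\to\sim\neg(\alpha\land\beta)$ (here $\to$ denotes $\longrightarrow$). Rules: (MP) from $\alpha$ and $\alpha\longrightarrow\beta$ infer $\beta$; (N) from $\alpha$ infer $\neg\alpha\longrightarrow\sim\alpha$, applicable only when $\alpha$ is a theorem. A derivation of $\varphi$ from $\Gamma$ is a finite sequence $\varphi_1,\dots,\varphi_n=\varphi$ where each $\varphi_i$ is an axiom instance, or belongs to $\Gamma$, or follows by MP from earlier members, or is obtained by (N) from an earlier $\varphi_j$ which is a theorem. $\Gamma\vdash_{\mathbf{vD}}\varphi$ means such a derivation exists; $\varphi$ is a theorem if $\emptyset\vdash_{\mathbf{vD}}\varphi$. *)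

theory Defs
  imports Main "HOL-Library.Countable_Set"
begin

datatype 'v fm =
    Var 'v
  | Neg "'v fm"  ("\<^bold>\<not> _" [140] 140)
  | Circ "'v fm"  ("\<^bold>\<circ> _" [140] 140)
  | Con "'v fm" "'v fm"  (infixr "\<^bold>\<and>" 135)
  | Dis "'v fm" "'v fm"  (infixr "\<^bold>\<or>" 130)
  | Imp "'v fm" "'v fm"  (infixr "\<^bold>\<longrightarrow>" 125)

text \<open>The fixed formula \<open>\<beta>\<^sub>0\<close> is an explicit parameter \<open>b\<close> of every notion that depends on it.\<close>

definition Bot :: "'v fm \<Rightarrow> 'v fm"  ("\<^bold>\<bottom>\<^bsub>_\<^esub>")
  where "\<^bold>\<bottom>\<^bsub>b\<^esub> = b \<^bold>\<and> (\<^bold>\<not> b \<^bold>\<and> \<^bold>\<circ> b)"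

definition SNeg :: "'v fm \<Rightarrow> 'v fm \<Rightarrow> 'v fm"  ("\<^bold>\<sim>\<^bsub>_\<^esub> _" [0, 140] 140)
  where "\<^bold>\<sim>\<^bsub>b\<^esub> \<alpha> = \<alpha> \<^bold>\<longrightarrow> \<^bold>\<bottom>\<^bsub>b\<^esub>"

inductive vD_axiom :: "'v fm \<Rightarrow> 'v fm \<Rightarrow> bool" for b :: "'v fm" where
  Ax1: "vD_axiom b (\<alpha> \<^bold>\<longrightarrow> (\<beta> \<^bold>\<longrightarrow> \<alpha>))"
| Ax2: "vD_axiom b ((\<alpha> \<^bold>\<longrightarrow> (\<beta> \<^bold>\<longrightarrow> \<gamma>)) \<^bold>\<longrightarrow> ((\<alpha> \<^bold>\<longrightarrow> \<beta>) \<^bold>\<longrightarrow> (\<alpha> \<^bold>\<longrightarrow> \<gamma>)))"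
| Ax3: "vD_axiom b (\<alpha> \<^bold>\<longrightarrow> (\<beta> \<^bold>\<longrightarrow> (\<alpha> \<^bold>\<and> \<beta>)))"
| Ax4: "vD_axiom b ((\<alpha> \<^bold>\<and> \<beta>) \<^bold>\<longrightarrow> \<alpha>)"
| Ax5: "vD_axiom b ((\<alpha> \<^bold>\<and> \<beta>) \<^bold>\<longrightarrow> \<beta>)"
| Ax6: "vD_axiom b (\<alpha> \<^bold>\<longrightarrow> (\<alpha> \<^bold>\<or> \<beta>))"
| Ax7: "vD_axiom b (\<beta> \<^bold>\<longrightarrow> (\<alpha> \<^bold>\<or> \<beta>))"
| Ax8: "vD_axiom b ((\<alpha> \<^bold>\<longrightarrow> \<beta>) \<^bold>\<or> \<alpha>)"
| Ax9: "vD_axiom b (\<alpha> \<^bold>\<or> \<^bold>\<not> \<alpha>)"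
| Ax10: "vD_axiom b ((\<alpha> \<^bold>\<longrightarrow> \<gamma>) \<^bold>\<longrightarrow> ((\<^bold>\<not> \<alpha> \<^bold>\<longrightarrow> \<gamma>) \<^bold>\<longrightarrow> ((\<alpha> \<^bold>\<or> \<^bold>\<not> \<alpha>) \<^bold>\<longrightarrow> \<gamma>)))"
| Ax11: "vD_axiom b (((\<alpha> \<^bold>\<longrightarrow> \<beta>) \<^bold>\<longrightarrow> \<gamma>) \<^bold>\<longrightarrow> ((\<alpha> \<^bold>\<longrightarrow> \<gamma>) \<^bold>\<longrightarrow> (((\<alpha> \<^bold>\<longrightarrow> \<beta>) \<^bold>\<or> \<alpha>) \<^bold>\<longrightarrow> \<gamma>)))"
| Ax12: "vD_axiom b (\<^bold>\<circ> \<alpha> \<^bold>\<longrightarrow> (\<alpha> \<^bold>\<longrightarrow> (\<^bold>\<not> \<alpha> \<^bold>\<longrightarrow> \<beta>)))"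
| Ax13: "vD_axiom b (\<^bold>\<circ> \<alpha> \<^bold>\<or> (\<alpha> \<^bold>\<and> \<^bold>\<not> \<alpha>))"
| Ax14: "vD_axiom b ((\<^bold>\<circ> \<alpha> \<^bold>\<longrightarrow> \<gamma>) \<^bold>\<longrightarrow> (((\<alpha> \<^bold>\<and> \<^bold>\<not> \<alpha>) \<^bold>\<longrightarrow> \<gamma>) \<^bold>\<longrightarrow> ((\<^bold>\<circ> \<alpha> \<^bold>\<or> (\<alpha> \<^bold>\<and> \<^bold>\<not> \<alpha>)) \<^bold>\<longrightarrow> \<gamma>)))"
| Ax15: "vD_axiom b (\<^bold>\<sim>\<^bsub>b\<^esub> \<^bold>\<not> \<alpha> \<^bold>\<longrightarrow> \<^bold>\<sim>\<^bsub>b\<^esub> \<^bold>\<not> \<^bold>\<sim>\<^bsub>b\<^esub> \<^bold>\<not> \<alpha>)"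
| Ax16: "vD_axiom b (\<^bold>\<sim>\<^bsub>b\<^esub> \<^bold>\<not> \<^bold>\<sim>\<^bsub>b\<^esub> \<^bold>\<not> \<alpha> \<^bold>\<longrightarrow> \<^bold>\<sim>\<^bsub>b\<^esub> \<^bold>\<not> \<alpha>)"
| Ax17: "vD_axiom b (\<^bold>\<sim>\<^bsub>b\<^esub> \<^bold>\<not> (\<alpha> \<^bold>\<and> \<beta>) \<^bold>\<longrightarrow> (\<^bold>\<sim>\<^bsub>b\<^esub> \<^bold>\<not> \<alpha> \<^bold>\<and> \<^bold>\<sim>\<^bsub>b\<^esub> \<^bold>\<not> \<beta>))"
| Ax18: "vD_axiom b ((\<^bold>\<sim>\<^bsub>b\<^esub> \<^bold>\<not> \<alpha> \<^bold>\<and> \<^bold>\<sim>\<^bsub>b\<^esub> \<^bold>\<not> \<beta>) \<^bold>\<longrightarrow> \<^bold>\<sim>\<^bsub>b\<^esub> \<^bold>\<not> (\<alpha> \<^bold>\<and> \<beta>))"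

text \<open>
  Derivations are lists, the newest formula at the end. The premise of rule (N) must occur
  earlier in the list and be a theorem, i.e. the last formula of some derivation from the
  empty set. As theoremhood is itself defined through derivations, the set of premises
  \<open>\<Gamma>\<close> is not a fixed parameter of the inductive definition.
\<close>

inductive vD_derivation :: "'v fm \<Rightarrow> 'v fm set \<Rightarrow> 'v fm list \<Rightarrow> bool" for b :: "'v fm" where
  Empty: "vD_derivation b \<Gamma> []"
| Axiom: "vD_derivation b \<Gamma> \<phi>s \<Longrightarrow> vD_axiom b \<phi> \<Longrightarrow> vD_derivation b \<Gamma> (\<phi>s @ [\<phi>])"
| Premise: "vD_derivation b \<Gamma> \<phi>s \<Longrightarrow> \<phi> \<in> \<Gamma> \<Longrightarrow> vD_derivation b \<Gamma> (\<phi>s @ [\<phi>])"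
| MP: "vD_derivation b \<Gamma> \<phi>s \<Longrightarrow> \<alpha> \<in> set \<phi>s \<Longrightarrow> \<alpha> \<^bold>\<longrightarrow> \<beta> \<in> set \<phi>s
    \<Longrightarrow> vD_derivation b \<Gamma> (\<phi>s @ [\<beta>])"
| N: "vD_derivation b \<Gamma> \<phi>s \<Longrightarrow> \<alpha> \<in> set \<phi>s \<Longrightarrow> vD_derivation b {} (\<psi>s @ [\<alpha>])
    \<Longrightarrow> vD_derivation b \<Gamma> (\<phi>s @ [\<^bold>\<not> \<alpha> \<^bold>\<longrightarrow> \<^bold>\<sim>\<^bsub>b\<^esub> \<alpha>])"

definition vD_derives :: "'v fm set \<Rightarrow> 'v fm \<Rightarrow> 'v fm \<Rightarrow> bool"  ("_ \<turnstile>\<^bsub>_\<^esub> _" [50, 0, 50] 50)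
  where "\<Gamma> \<turnstile>\<^bsub>b\<^esub> \<phi> \<longleftrightarrow> (\<exists>\<phi>s. vD_derivation b \<Gamma> (\<phi>s @ [\<phi>]))"

end

theory Submission
  imports Defs
begin

text \<open>Each rule only asks that its premises occur somewhere earlier, so a valid prefix
  invalidates no step; the theoremhood witness in \<open>N\<close> is a separate list and stays
  unchanged. Induction is on the right-hand list because derivations grow at the end.\<close>

lemma vD_derivation_append:
  assumes "vD_derivation b \<Gamma> \<psi>s" and "vD_derivation b \<Gamma> \<phi>s"
  shows "vD_derivation b \<Gamma> (\<phi>s @ \<psi>s)"
  using assms
proof (induction rule: vD_derivation.induct)
  case (Empty \<Gamma>)
  then show ?case by simp
next
  case (Axiom \<Gamma> \<psi>s \<psi>)
  then show ?case
    using vD_derivation.Axiom[of b \<Gamma> "\<phi>s @ \<psi>s" \<psi>] by simp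
next
  case (Premise \<Gamma> \<psi>s \<psi>)
  then show ?case
    using vD_derivation.Premise[of b \<Gamma> "\<phi>s @ \<psi>s" \<psi>] by simp
next
  case (MP \<Gamma> \<psi>s \<alpha> \<beta>)
  then show ?case
    using vD_derivation.MP[of b \<Gamma> "\<phi>s @ \<psi>s" \<alpha> \<beta>] by simp
next
  case (N \<Gamma> \<psi>s \<alpha> \<chi>s)
  then show ?case
    using vD_derivation.N[of b \<Gamma> "\<phi>s @ \<psi>s" \<alpha> \<chi>s] by simp
qed

lemma vD_derives_axiom:
  assumes "vD_axiom b \<phi>"
  shows "\<Gamma> \<turnstile>\<^bsub>b\<^esub> \<phi>"
  unfolding vD_derives_def using assms vD_derivation.Axiom vD_derivation.Empty by blast

lemma vD_derives_MP:
  assumes "\<Gamma> \<turnstile>\<^bsub>b\<^esub> \<alpha> \<^bold>\<longrightarrow> \<beta>" and "\<Gamma> \<turnstile>\<^bsub>b\<^esub> \<alpha>"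
  shows "\<Gamma> \<turnstile>\<^bsub>b\<^esub> \<beta>"
proof -
  obtain \<phi>s \<psi>s where "vD_derivation b \<Gamma> (\<phi>s @ [\<alpha> \<^bold>\<longrightarrow> \<beta>])" and "vD_derivation b \<Gamma> (\<psi>s @ [\<alpha>])"
    using assms unfolding vD_derives_def by blast
  then have "vD_derivation b \<Gamma> ((\<psi>s @ [\<alpha>]) @ (\<phi>s @ [\<alpha> \<^bold>\<longrightarrow> \<beta>]))"
    by (rule vD_derivation_append)
  then have "vD_derivation b \<Gamma> (((\<psi>s @ [\<alpha>]) @ (\<phi>s @ [\<alpha> \<^bold>\<longrightarrow> \<beta>])) @ [\<beta>])"
    by (rule vD_derivation.MP[where \<alpha> = \<alpha>]) simp_all
  then show ?thesis
    unfolding vD_derives_def by blast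
qed

lemma vD_derives_imp_const:
  assumes "\<Gamma> \<turnstile>\<^bsub>b\<^esub> \<beta>"
  shows "\<Gamma> \<turnstile>\<^bsub>b\<^esub> \<alpha> \<^bold>\<longrightarrow> \<beta>"
  by (rule vD_derives_MP[OF vD_derives_axiom[OF Ax1] assms])

lemma vD_derives_imp_distrib:
  assumes "\<Gamma> \<turnstile>\<^bsub>b\<^esub> \<alpha> \<^bold>\<longrightarrow> (\<beta> \<^bold>\<longrightarrow> \<gamma>)"
  shows "\<Gamma> \<turnstile>\<^bsub>b\<^esub> (\<alpha> \<^bold>\<longrightarrow> \<beta>) \<^bold>\<longrightarrow> (\<alpha> \<^bold>\<longrightarrow> \<gamma>)"
  by (rule vD_derives_MP[OF vD_derives_axiom[OF Ax2] assms])

text \<open>Modus ponens under a common antecedent. Together with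
  \<open>vD_derives_imp_const\<close> it permits reasoning under a hypothesis.\<close>

lemma vD_derives_imp_MP:
  assumes "\<Gamma> \<turnstile>\<^bsub>b\<^esub> \<alpha> \<^bold>\<longrightarrow> (\<beta> \<^bold>\<longrightarrow> \<gamma>)" and "\<Gamma> \<turnstile>\<^bsub>b\<^esub> \<alpha> \<^bold>\<longrightarrow> \<beta>"
  shows "\<Gamma> \<turnstile>\<^bsub>b\<^esub> \<alpha> \<^bold>\<longrightarrow> \<gamma>"
  by (rule vD_derives_MP[OF vD_derives_imp_distrib[OF assms(1)] assms(2)])

lemma vD_derives_imp_trans:
  assumes "\<Gamma> \<turnstile>\<^bsub>b\<^esub> \<alpha> \<^bold>\<longrightarrow> \<beta>" and "\<Gamma> \<turnstile>\<^bsub>b\<^esub> \<beta> \<^bold>\<longrightarrow> \<gamma>"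
  shows "\<Gamma> \<turnstile>\<^bsub>b\<^esub> \<alpha> \<^bold>\<longrightarrow> \<gamma>"
  by (rule vD_derives_imp_MP[OF vD_derives_imp_const[OF assms(2)] assms(1)])

lemma vD_derives_imp_refl: "\<Gamma> \<turnstile>\<^bsub>b\<^esub> \<alpha> \<^bold>\<longrightarrow> \<alpha>"
  by (rule vD_derives_imp_MP[OF vD_derives_axiom[OF Ax1] vD_derives_axiom[OF Ax1[of _ _ \<alpha>]]])

text \<open>The three conjuncts of bottom are exactly the three antecedents of \<open>Ax12\<close>
  at \<open>b\<close>; each is projected out and discharged under the hypothesis bottom.\<close>

lemma vD_derives_Bot_imp: "\<Gamma> \<turnstile>\<^bsub>b\<^esub> \<^bold>\<bottom>\<^bsub>b\<^esub> \<^bold>\<longrightarrow> \<beta>"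
proof -
  have b: "\<Gamma> \<turnstile>\<^bsub>b\<^esub> \<^bold>\<bottom>\<^bsub>b\<^esub> \<^bold>\<longrightarrow> b"
    unfolding Bot_def by (rule vD_derives_axiom[OF Ax4])
  have rest: "\<Gamma> \<turnstile>\<^bsub>b\<^esub> \<^bold>\<bottom>\<^bsub>b\<^esub> \<^bold>\<longrightarrow> (\<^bold>\<not> b \<^bold>\<and> \<^bold>\<circ> b)"
    unfolding Bot_def by (rule vD_derives_axiom[OF Ax5])
  have neg: "\<Gamma> \<turnstile>\<^bsub>b\<^esub> \<^bold>\<bottom>\<^bsub>b\<^esub> \<^bold>\<longrightarrow> \<^bold>\<not> b"
    by (rule vD_derives_imp_trans[OF rest vD_derives_axiom[OF Ax4]])
  have "\<Gamma> \<turnstile>\<^bsub>b\<^esub> \<^bold>\<bottom>\<^bsub>b\<^esub> \<^bold>\<longrightarrow> \<^bold>\<circ> b"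
    by (rule vD_derives_imp_trans[OF rest vD_derives_axiom[OF Ax5]])
  then have "\<Gamma> \<turnstile>\<^bsub>b\<^esub> \<^bold>\<bottom>\<^bsub>b\<^esub> \<^bold>\<longrightarrow> (b \<^bold>\<longrightarrow> (\<^bold>\<not> b \<^bold>\<longrightarrow> \<beta>))"
    by (rule vD_derives_imp_trans[OF _ vD_derives_axiom[OF Ax12]])
  then show ?thesis
    by (rule vD_derives_imp_MP[OF vD_derives_imp_MP[OF _ b] neg])
qed

lemma vD_derives_SNeg_explosion: "\<Gamma> \<turnstile>\<^bsub>b\<^esub> \<alpha> \<^bold>\<longrightarrow> (\<^bold>\<sim>\<^bsub>b\<^esub> \<alpha> \<^bold>\<longrightarrow> \<beta>)"
proof -
  \<comment> \<open>The identity on the strong negation of \<alpha>, read as an implication whose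
    consequent is again an implication. Distributing it and precomposing with \<open>Ax1\<close>
    swaps the two antecedents.\<close>
  have "\<Gamma> \<turnstile>\<^bsub>b\<^esub> \<^bold>\<sim>\<^bsub>b\<^esub> \<alpha> \<^bold>\<longrightarrow> (\<alpha> \<^bold>\<longrightarrow> \<^bold>\<bottom>\<^bsub>b\<^esub>)"
    unfolding SNeg_def by (rule vD_derives_imp_refl)
  then have "\<Gamma> \<turnstile>\<^bsub>b\<^esub> (\<^bold>\<sim>\<^bsub>b\<^esub> \<alpha> \<^bold>\<longrightarrow> \<alpha>) \<^bold>\<longrightarrow> (\<^bold>\<sim>\<^bsub>b\<^esub> \<alpha> \<^bold>\<longrightarrow> \<^bold>\<bottom>\<^bsub>b\<^esub>)"
    by (rule vD_derives_imp_distrib)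
  then have "\<Gamma> \<turnstile>\<^bsub>b\<^esub> \<alpha> \<^bold>\<longrightarrow> (\<^bold>\<sim>\<^bsub>b\<^esub> \<alpha> \<^bold>\<longrightarrow> \<^bold>\<bottom>\<^bsub>b\<^esub>)"
    by (rule vD_derives_imp_trans[OF vD_derives_axiom[OF Ax1]])
  then show ?thesis
    by (rule vD_derives_imp_trans
        [OF _ vD_derives_imp_distrib[OF vD_derives_imp_const[OF vD_derives_Bot_imp]]])
qed

lemma vD_derives_SNeg_excluded_middle: "\<Gamma> \<turnstile>\<^bsub>b\<^esub> \<^bold>\<sim>\<^bsub>b\<^esub> \<alpha> \<^bold>\<or> \<alpha>"
  unfolding SNeg_def by (rule vD_derives_axiom[OF Ax8])

theorem theorem2p8:
  fixes \<beta>\<^sub>0 \<alpha> \<beta> :: "'v fm"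
  assumes "countable (UNIV :: 'v set)" and "infinite (UNIV :: 'v set)"
  shows "({} \<turnstile>\<^bsub>\<beta>\<^sub>0\<^esub> \<alpha> \<^bold>\<longrightarrow> (\<^bold>\<sim>\<^bsub>\<beta>\<^sub>0\<^esub> \<alpha> \<^bold>\<longrightarrow> \<beta>)) \<and> ({} \<turnstile>\<^bsub>\<beta>\<^sub>0\<^esub> \<^bold>\<sim>\<^bsub>\<beta>\<^sub>0\<^esub> \<alpha> \<^bold>\<or> \<alpha>)"
  by (intro conjI vD_derives_SNeg_explosion vD_derives_SNeg_excluded_middle)

end
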